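(* Let $S=(2,2,2,\ldots)$ be the infinite sequence with $a_i=2$ for all $i\geq 1$. Then $\chi_S''(P_n)=5$ for every $n\geq 3$.
   Context: $P_n$ is the path on $n$ vertices. For vertices $u,v$ of a graph $G$, $d(u,v)$ is the usual shortest-path distance. For a vertex $u$ and an edge $ab$, $d(u,ab)=d(ab,u)=\min\{d(u,a),d(u,b)\}+1$. For two distinct edges $ab,cd$, $d(ab,cd)=\min\{d(a,c),d(a,d),d(b,c),d(b,d)\}+1$. For a non-decreasing infinite sequence $S=(a_1,a_2,\ldots)$ of positive integers, an $S$-packing total coloring of $G$ using $k$ colors is a map $c:V(G)\cup E(G)\to\{1,\ldots,k\}$ such that any two distinct elements $A,B\in V(G)\cup E(G)$ with $c(A)=c(B)=i$ satisfy $d(A,B)>a_i$. The $S$-packing total chromatic number $\chi_S''(G)$ is the smallest $k$ for which one exists. *)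

theory Defs
  imports Main "HOL-Library.Extended_Nat"
begin

record 'a ugraph =
  verts :: "'a set"
  edges :: "'a set set"

definition simple_graph :: "'a ugraph \<Rightarrow> bool" where
  "simple_graph G \<longleftrightarrow>
     (\<forall>e\<in>edges G. \<exists>a\<in>verts G. \<exists>b\<in>verts G. a \<noteq> b \<and> e = {a, b})"

definition walk :: "'a ugraph \<Rightarrow> 'a list \<Rightarrow> bool" where
  "walk G p \<longleftrightarrow> p \<noteq> [] \<and> set p \<subseteq> verts G \<and>
     (\<forall>i. Suc i < length p \<longrightarrow> {p ! i, p ! Suc i} \<in> edges G)"

text \<open>The length of a walk is its number of edges. The distance is \<open>\<infinity>\<close> if no walk
  joins the two vertices (infimum of the empty set).\<close>

definition vdist :: "'a ugraph \<Rightarrow> 'a \<Rightarrow> 'a \<Rightarrow> enat" where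
  "vdist G u v = (INF p \<in> {p. walk G p \<and> hd p = u \<and> last p = v}. enat (length p - 1))"

text \<open>In the disjoint sum, \<open>Inl u\<close> is the vertex \<open>u\<close> and \<open>Inr e\<close> is the edge \<open>e\<close>.\<close>

type_synonym 'a elem = "'a + 'a set"

definition elems :: "'a ugraph \<Rightarrow> 'a elem set" where
  "elems G = verts G <+> edges G"

text \<open>For two edges the value is only meaningful when they are distinct; the formula
  gives 1 for an edge and itself.\<close>

fun tdist :: "'a ugraph \<Rightarrow> 'a elem \<Rightarrow> 'a elem \<Rightarrow> enat" where
  "tdist G (Inl u) (Inl v) = vdist G u v"
| "tdist G (Inl u) (Inr e) = (INF a\<in>e. vdist G u a) + 1"
| "tdist G (Inr e) (Inl u) = (INF a\<in>e. vdist G u a) + 1"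
| "tdist G (Inr e) (Inr f) = (INF a\<in>e. INF b\<in>f. vdist G a b) + 1"

text \<open>A sequence is indexed from 1; the value of the function at 0 is irrelevant.\<close>

definition packing_sequence :: "(nat \<Rightarrow> nat) \<Rightarrow> bool" where
  "packing_sequence S \<longleftrightarrow> (\<forall>i\<ge>1. 0 < S i) \<and> mono_on {1..} S"

definition packing_total_coloring ::
    "(nat \<Rightarrow> nat) \<Rightarrow> 'a ugraph \<Rightarrow> nat \<Rightarrow> ('a elem \<Rightarrow> nat) \<Rightarrow> bool" where
  "packing_total_coloring S G k c \<longleftrightarrow>
     packing_sequence S \<and> c ` elems G \<subseteq> {1..k} \<and>
     (\<forall>A\<in>elems G. \<forall>B\<in>elems G. A \<noteq> B \<and> c A = c B \<longrightarrow> enat (S (c A)) < tdist G A B)"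

text \<open>Since \<open>enat\<close> is well-ordered, the infimum is the smallest such number of colors,
  and it is \<open>\<infinity>\<close> if there is none.\<close>

definition packing_total_chromatic_number :: "(nat \<Rightarrow> nat) \<Rightarrow> 'a ugraph \<Rightarrow> enat" where
  "packing_total_chromatic_number S G =
     (INF k \<in> {k. \<exists>c. packing_total_coloring S G k c}. enat k)"

definition path_graph :: "nat \<Rightarrow> nat ugraph" where
  "path_graph n = \<lparr>verts = {1..n}, edges = {{i, i + 1} | i. 1 \<le> i \<and> i < n}\<rparr>"

lemma simple_graph_path_graph: "simple_graph (path_graph n)"
proof -
  have "\<exists>a\<in>{1..n}. \<exists>b\<in>{1..n}. a \<noteq> b \<and> {i, i + 1} = {a, b}"
    if "1 \<le> i" "i < n" for i
    using that by (intro bexI[of _ i] bexI[of _ "i + 1"]) auto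
  then show ?thesis
    unfolding simple_graph_def path_graph_def by force
qed

end

theory Submission
  imports Defs
begin

text \<open>List the elements of the path alternately, \<open>v\<^sub>1, v\<^sub>1v\<^sub>2, v\<^sub>2, v\<^sub>2v\<^sub>3, v\<^sub>3, \<dots>\<close>. The conventions
  for distances involving edges make the distance of two distinct elements half of their distance in this
  list, rounded up (\<open>tdist_path_graph\<close>). Hence two elements are at distance greater than 2 exactly
  when they are at least five places apart: any five consecutive elements need five different
  colors, and repeating five colors periodically along the list is a valid coloring. Five
  consecutive elements exist exactly when there are at least three vertices.

  The only input from graph theory is that \<open>d(i, j) = \<bar>i - j\<bar>\<close> in a path: one step of a
  walk changes the vertex number by one, and walking straight ahead attains this bound.\<close>

lemma walk_rev:
  assumes "walk G p"
  shows "walk G (rev p)"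
  unfolding walk_def
proof (intro conjI allI impI)
  show "rev p \<noteq> []" "set (rev p) \<subseteq> verts G"
    using assms by (auto simp: walk_def)
  fix i assume i: "Suc i < length (rev p)"
  define j where "j = length p - Suc (Suc i)"
  have "Suc j < length p" "rev p ! i = p ! Suc j" "rev p ! Suc i = p ! j"
    using i by (auto simp: j_def rev_nth Suc_diff_Suc)
  then show "{rev p ! i, rev p ! Suc i} \<in> edges G"
    using assms by (auto simp: walk_def insert_commute)
qed

lemma vdist_le_walk:
  assumes "walk G p" "hd p = u" "last p = v"
  shows "vdist G u v \<le> enat (length p - 1)"
  unfolding vdist_def by (rule INF_lower) (use assms in auto)

lemma vdist_commute_le: "vdist G u v \<le> vdist G v u"
  unfolding vdist_def[of G v u]
proof (rule INF_greatest)
  fix p assume "p \<in> {p. walk G p \<and> hd p = v \<and> last p = u}"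
  then have "walk G (rev p)" "hd (rev p) = u" "last (rev p) = v"
    by (auto simp: walk_rev hd_rev last_rev)
  from vdist_le_walk[OF this] show "vdist G u v \<le> enat (length p - 1)"
    by simp
qed

lemma vdist_commute: "vdist G u v = vdist G v u"
  by (intro antisym vdist_commute_le)

lemma walk_path_graph_displacement:
  assumes "walk (path_graph n) p" "i < length p"
  shows "\<bar>int (p ! i) - int (p ! 0)\<bar> \<le> int i"
  using assms(2)
proof (induction i)
  case 0
  then show ?case by simp
next
  case (Suc i)
  have "{p ! i, p ! Suc i} \<in> edges (path_graph n)"
    using assms(1) Suc.prems by (simp add: walk_def)
  then have "\<bar>int (p ! Suc i) - int (p ! i)\<bar> = 1"
    by (auto simp: path_graph_def doubleton_eq_iff)
  moreover have "\<bar>int (p ! i) - int (p ! 0)\<bar> \<le> int i"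
    using Suc by simp
  ultimately show ?case by linarith
qed

lemma walk_path_graph_upt:
  assumes "1 \<le> i" "i \<le> j" "j \<le> n"
  shows "walk (path_graph n) [i..<Suc j]"
  unfolding walk_def
proof (intro conjI allI impI)
  show "[i..<Suc j] \<noteq> []" "set [i..<Suc j] \<subseteq> verts (path_graph n)"
    using assms by (auto simp: path_graph_def)
  fix k assume k: "Suc k < length [i..<Suc j]"
  then have "[i..<Suc j] ! k = i + k" "[i..<Suc j] ! Suc k = i + k + 1"
    by (auto simp del: upt_Suc)
  then show "{[i..<Suc j] ! k, [i..<Suc j] ! Suc k} \<in> edges (path_graph n)"
    using k assms by (auto simp: path_graph_def simp del: upt_Suc)
qed

lemma vdist_path_graph:
  assumes "i \<in> {1..n}" "j \<in> {1..n}"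
  shows "vdist (path_graph n) i j = enat (nat \<bar>int i - int j\<bar>)"
proof (rule antisym)
  have straight: "vdist (path_graph n) a b \<le> enat (b - a)" if "1 \<le> a" "a \<le> b" "b \<le> n" for a b
    using vdist_le_walk[OF walk_path_graph_upt[OF that]] that
    by (simp add: hd_append)
  show "vdist (path_graph n) i j \<le> enat (nat \<bar>int i - int j\<bar>)"
  proof (cases "i \<le> j")
    case True
    then show ?thesis using straight[of i j] assms by (simp add: nat_diff_distrib)
  next
    case False
    then show ?thesis
      using straight[of j i] assms by (simp add: nat_diff_distrib vdist_commute[of _ i])
  qed
next
  show "enat (nat \<bar>int i - int j\<bar>) \<le> vdist (path_graph n) i j"
    unfolding vdist_def
  proof (rule INF_greatest)
    fix p assume "p \<in> {p. walk (path_graph n) p \<and> hd p = i \<and> last p = j}"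
    then have p: "walk (path_graph n) p" "p \<noteq> []" "p ! 0 = i" "p ! (length p - 1) = j"
      by (auto simp: walk_def hd_conv_nth last_conv_nth)
    then have "\<bar>int j - int i\<bar> \<le> int (length p - 1)"
      using walk_path_graph_displacement[OF p(1), of "length p - 1"] by simp
    then show "enat (nat \<bar>int i - int j\<bar>) \<le> enat (length p - 1)"
      by simp
  qed
qed

text \<open>The place of an element in the alternating list. The endpoints of the edge \<open>{i, i + 1}\<close> add
  up to \<open>2 * i + 1\<close>, which is halfway between the places of the two endpoints; the
  list thus occupies the places \<open>2, \<dots>, 2 * n\<close>.\<close>

fun place :: "nat elem \<Rightarrow> nat" where
  "place (Inl v) = 2 * v"
| "place (Inr e) = \<Sum>e"

lemma path_graph_elem_cases:
  assumes "A \<in> elems (path_graph n)"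
  obtains (vertex) i where "A = Inl i" "1 \<le> i" "i \<le> n" "place A = 2 * i"
  | (edge) i where "A = Inr {i, Suc i}" "1 \<le> i" "i < n" "place A = 2 * i + 1"
  using assms by (auto simp: elems_def path_graph_def)

lemma inj_on_place: "inj_on place (elems (path_graph n))"
proof (rule inj_onI)
  fix A B assume "A \<in> elems (path_graph n)" "B \<in> elems (path_graph n)" "place A = place B"
  then show "A = B"
    by (elim path_graph_elem_cases) (auto dest: arg_cong[where f = even])
qed

lemma place_image: "place ` elems (path_graph n) = {2..2 * n}"
proof (intro equalityI subsetI)
  fix q assume "q \<in> place ` elems (path_graph n)"
  then show "q \<in> {2..2 * n}"
    by (auto elim!: path_graph_elem_cases)
next
  fix q assume q: "q \<in> {2..2 * n}"
  show "q \<in> place ` elems (path_graph n)"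
  proof (cases "even q")
    case True
    then have "place (Inl (q div 2)) = q" "Inl (q div 2) \<in> elems (path_graph n)"
      using q by (auto simp: elems_def path_graph_def)
    then show ?thesis by (metis imageI)
  next
    case False
    then have "place (Inr {q div 2, q div 2 + 1}) = q" by simp presburger
    moreover have "1 \<le> q div 2" "q div 2 < n"
      using q False by (auto elim!: oddE)
    then have "Inr {q div 2, q div 2 + 1} \<in> elems (path_graph n)"
      by (auto simp: elems_def path_graph_def)
    ultimately show ?thesis by (metis imageI)
  qed
qed

text \<open>The extra 1 in the distances from an edge compensates the steps of length one half from the
  edge to its endpoints. From an edge to a vertex there is only one such step, so that the
  distance of the places is odd and gets rounded up.\<close>

lemma tdist_path_graph:
  assumes "A \<in> elems (path_graph n)" "B \<in> elems (path_graph n)" "A \<noteq> B"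
  shows "tdist (path_graph n) A B = enat (nat ((\<bar>int (place A) - int (place B)\<bar> + 1) div 2))"
  using assms(1)
proof (cases A rule: path_graph_elem_cases)
  case (vertex i)
  note A = this
  show ?thesis using assms(2)
  proof (cases B rule: path_graph_elem_cases)
    case (vertex j)
    have "nat \<bar>int i - int j\<bar> = nat ((\<bar>2 * int i - 2 * int j\<bar> + 1) div 2)"
      by linarith
    then show ?thesis using A vertex by (simp add: vdist_path_graph)
  next
    case (edge j)
    have "min (nat \<bar>int i - int j\<bar>) (nat \<bar>int i - int (Suc j)\<bar>) + 1
        = nat ((\<bar>2 * int i - (1 + 2 * int j)\<bar> + 1) div 2)"
      by linarith
    then show ?thesis using A edge
      by (simp add: vdist_path_graph one_enat_def inf_min)
  qed
next
  case (edge i)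
  note A = this
  show ?thesis using assms(2)
  proof (cases B rule: path_graph_elem_cases)
    case (vertex j)
    have "min (nat \<bar>int j - int i\<bar>) (nat \<bar>int j - int (Suc i)\<bar>) + 1
        = nat ((\<bar>1 + 2 * int i - 2 * int j\<bar> + 1) div 2)"
      by linarith
    then show ?thesis using A vertex
      by (simp add: vdist_path_graph one_enat_def inf_min)
  next
    case (edge j)
    have "i \<noteq> j" using A edge assms(3) by auto
    then have "min (min (nat \<bar>int i - int j\<bar>) (nat \<bar>int i - int (Suc j)\<bar>))
          (min (nat \<bar>int (Suc i) - int j\<bar>) (nat \<bar>int (Suc i) - int (Suc j)\<bar>)) + 1
        = nat ((\<bar>2 * int i - 2 * int j\<bar> + 1) div 2)"
      by (cases "i < j") (auto simp: min_def)
    then show ?thesis using A edge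
      by (simp add: vdist_path_graph one_enat_def inf_min)
  qed
qed

lemma tdist_path_graph_gt_2_iff:
  assumes "A \<in> elems (path_graph n)" "B \<in> elems (path_graph n)" "A \<noteq> B"
  shows "enat 2 < tdist (path_graph n) A B \<longleftrightarrow> 5 \<le> \<bar>int (place A) - int (place B)\<bar>"
  unfolding tdist_path_graph[OF assms] enat_ord_simps by linarith

lemma packing_total_coloring_path_graph_iff:
  assumes "\<And>i. i \<ge> 1 \<Longrightarrow> S i = 2"
  shows "packing_total_coloring S (path_graph n) k c \<longleftrightarrow>
    c ` elems (path_graph n) \<subseteq> {1..k} \<and>
    (\<forall>A\<in>elems (path_graph n). \<forall>B\<in>elems (path_graph n).
      A \<noteq> B \<and> c A = c B \<longrightarrow> 5 \<le> \<bar>int (place A) - int (place B)\<bar>)"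
proof -
  have "packing_sequence S"
    by (auto simp: packing_sequence_def mono_on_def assms)
  moreover have "S (c A) = 2" if "c ` elems (path_graph n) \<subseteq> {1..k}" "A \<in> elems (path_graph n)" for A
    using that by (intro assms) auto
  ultimately show ?thesis
    unfolding packing_total_coloring_def
    by (auto simp flip: tdist_path_graph_gt_2_iff)
qed

theorem proposition17:
  fixes S :: "nat \<Rightarrow> nat" and n :: nat
  assumes "\<And>i. i \<ge> 1 \<Longrightarrow> S i = 2"
    and "n \<ge> 3"
  shows "packing_total_chromatic_number S (path_graph n) = 5"
proof -
  have coloring_iff: "packing_total_coloring S (path_graph n) k c \<longleftrightarrow>
    c ` elems (path_graph n) \<subseteq> {1..k} \<and>
    (\<forall>A\<in>elems (path_graph n). \<forall>B\<in>elems (path_graph n).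
      A \<noteq> B \<and> c A = c B \<longrightarrow> 5 \<le> \<bar>int (place A) - int (place B)\<bar>)" for k c
    by (rule packing_total_coloring_path_graph_iff) (rule assms(1))
  have far: "5 \<le> \<bar>int p - int q\<bar>" if "p \<noteq> q" "p mod 5 = q mod 5" for p q :: nat
  proof -
    have "5 dvd int p - int q"
      using that(2) by (metis mod_eq_dvd_iff of_nat_mod of_nat_numeral)
    then show ?thesis
      using dvd_imp_le_int[of "int p - int q" 5] that(1) by simp
  qed
  have "packing_total_coloring S (path_graph n) 5 (\<lambda>A. place A mod 5 + 1)"
    unfolding coloring_iff
  proof (intro conjI ballI impI)
    show "(\<lambda>A. place A mod 5 + 1) ` elems (path_graph n) \<subseteq> {1..5}"
      by (auto simp: Suc_le_eq)
    fix A B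
    assume "A \<in> elems (path_graph n)" "B \<in> elems (path_graph n)"
      and AB: "A \<noteq> B \<and> place A mod 5 + 1 = place B mod 5 + 1"
    then have "place A \<noteq> place B"
      using inj_on_place by (auto dest: inj_onD)
    then show "5 \<le> \<bar>int (place A) - int (place B)\<bar>"
      using AB by (intro far) auto
  qed
  then have upper: "packing_total_chromatic_number S (path_graph n) \<le> enat 5"
    unfolding packing_total_chromatic_number_def by (intro INF_lower) auto
  have "5 \<le> k" if "packing_total_coloring S (path_graph n) k c" for k c
  proof -
    define F where "F = {A \<in> elems (path_graph n). place A \<in> {2..6}}"
    have "place ` F = place ` elems (path_graph n) \<inter> {2..6}"
      by (auto simp: F_def)
    also have "\<dots> = {2..6}"
      unfolding place_image using assms(2) by auto
    finally have "place ` F = {2..6}" .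
    moreover have "inj_on place F"
      using inj_on_place by (rule inj_on_subset) (auto simp: F_def)
    ultimately have "card F = 5"
      using card_image by fastforce
    have "inj_on c F"
    proof (rule inj_onI, rule ccontr)
      fix A B assume AB: "A \<in> F" "B \<in> F" "c A = c B" "A \<noteq> B"
      then have "5 \<le> \<bar>int (place A) - int (place B)\<bar>"
        using that unfolding coloring_iff F_def by blast
      then show False using AB by (auto simp: F_def)
    qed
    moreover have "c ` F \<subseteq> {1..k}"
      using that unfolding coloring_iff F_def by blast
    ultimately have "card F \<le> card {1..k}"
      by (intro card_inj_on_le) auto
    then show ?thesis using \<open>card F = 5\<close> by simp
  qed
  then have "enat 5 \<le> packing_total_chromatic_number S (path_graph n)"
    unfolding packing_total_chromatic_number_def by (intro INF_greatest) auto
  with upper show ?thesis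
    by (simp add: numeral_eq_enat)
qed

end
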